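(* For any two bounded operators $W_1$ and $W_2$ on $\mathcal H$, $\|W_1+W_2\|_\mu\le\|W_1\|_\mu+\|W_2\|_\mu$.
   Context: $(\mathcal X,\mathcal B,\mu)$ is a probability measure space and $\mathcal H=L^2(\mathcal X,\mu)$ (complex-valued). For $X\in\mathcal B$, $\pi_X:\mathcal H\to\mathcal H$ is the orthogonal projector $\pi_Xf=\mathbf 1_X f$. A partition is a finite family $\chi=\{Y_1,\dots,Y_J\}\subset\mathcal B$ with $\mu(\mathcal X\setminus\bigcup_j Y_j)=0$ and $\mu(Y_j\cap Y_k)=0$ for $j\ne k$. For a bounded operator $W$ on $\mathcal H$ with operator norm $\|W\|$, put $\mathcal M_\chi(W)=\sum_{j=1}^J\mu(Y_j)\|W\pi_{Y_j}\|^2$, and define the $\mu$-norm $\|W\|_\mu=\inf_\chi\sqrt{\mathcal M_\chi(W)}$, the infimum being over all partitions $\chi$. *)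

theory Defs
  imports "HOL-Probability.Probability_Measure"
begin

text \<open>The complex Hilbert space of square-integrable functions on a measure space, as a set of
  almost-everywhere classes. Vector space operations act on representatives; the lemmas
  below show that the choice of representatives is immaterial.\<close>

definition sq_integrable :: "'a measure \<Rightarrow> ('a \<Rightarrow> complex) set" where
  "sq_integrable M = {f \<in> borel_measurable M. integrable M (\<lambda>x. (cmod (f x))\<^sup>2)}"

definition ae_rel :: "'a measure \<Rightarrow> (('a \<Rightarrow> complex) \<times> ('a \<Rightarrow> complex)) set" where
  "ae_rel M = {(f, g). f \<in> sq_integrable M \<and> g \<in> sq_integrable M \<and> (AE x in M. f x = g x)}"

definition L2 :: "'a measure \<Rightarrow> ('a \<Rightarrow> complex) set set" where
  "L2 M = sq_integrable M // ae_rel M"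

definition ae_class :: "'a measure \<Rightarrow> ('a \<Rightarrow> complex) \<Rightarrow> ('a \<Rightarrow> complex) set" where
  "ae_class M f = ae_rel M `` {f}"

definition rep :: "('a \<Rightarrow> complex) set \<Rightarrow> 'a \<Rightarrow> complex" where
  "rep F = (SOME f. f \<in> F)"

definition L2_add ::
    "'a measure \<Rightarrow> ('a \<Rightarrow> complex) set \<Rightarrow> ('a \<Rightarrow> complex) set \<Rightarrow> ('a \<Rightarrow> complex) set" where
  "L2_add M F G = ae_class M (\<lambda>x. rep F x + rep G x)"

definition L2_scale ::
    "'a measure \<Rightarrow> complex \<Rightarrow> ('a \<Rightarrow> complex) set \<Rightarrow> ('a \<Rightarrow> complex) set" where
  "L2_scale M c F = ae_class M (\<lambda>x. c * rep F x)"

definition L2_norm :: "'a measure \<Rightarrow> ('a \<Rightarrow> complex) set \<Rightarrow> real" where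
  "L2_norm M F = sqrt (\<integral>x. (cmod (rep F x))\<^sup>2 \<partial>M)"

definition L2_proj :: "'a measure \<Rightarrow> 'a set \<Rightarrow> ('a \<Rightarrow> complex) set \<Rightarrow> ('a \<Rightarrow> complex) set" where
  "L2_proj M X F = ae_class M (\<lambda>x. indicator X x * rep F x)"

text \<open>Operators are functions on classes; only their values on \<^term>\<open>L2 M\<close> matter.\<close>

definition bounded_op ::
    "'a measure \<Rightarrow> (('a \<Rightarrow> complex) set \<Rightarrow> ('a \<Rightarrow> complex) set) \<Rightarrow> bool" where
  "bounded_op M W \<longleftrightarrow>
     W \<in> L2 M \<rightarrow> L2 M \<and>
     (\<forall>F\<in>L2 M. \<forall>G\<in>L2 M. W (L2_add M F G) = L2_add M (W F) (W G)) \<and>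
     (\<forall>c. \<forall>F\<in>L2 M. W (L2_scale M c F) = L2_scale M c (W F)) \<and>
     (\<exists>C. \<forall>F\<in>L2 M. L2_norm M (W F) \<le> C * L2_norm M F)"

definition op_add ::
    "'a measure \<Rightarrow> (('a \<Rightarrow> complex) set \<Rightarrow> ('a \<Rightarrow> complex) set) \<Rightarrow>
     (('a \<Rightarrow> complex) set \<Rightarrow> ('a \<Rightarrow> complex) set) \<Rightarrow>
     (('a \<Rightarrow> complex) set \<Rightarrow> ('a \<Rightarrow> complex) set)" where
  "op_add M V W = (\<lambda>F. L2_add M (V F) (W F))"

definition op_norm ::
    "'a measure \<Rightarrow> (('a \<Rightarrow> complex) set \<Rightarrow> ('a \<Rightarrow> complex) set) \<Rightarrow> real" where
  "op_norm M W = (SUP F\<in>{F \<in> L2 M. L2_norm M F \<le> 1}. L2_norm M (W F))"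

text \<open>A partition is given by its length and an indexed family, so repeated
  (necessarily null) members are allowed.\<close>

definition is_partition :: "'a measure \<Rightarrow> nat \<Rightarrow> (nat \<Rightarrow> 'a set) \<Rightarrow> bool" where
  "is_partition M J Y \<longleftrightarrow>
     (\<forall>j\<in>{1..J}. Y j \<in> sets M) \<and>
     measure M (space M - (\<Union>j\<in>{1..J}. Y j)) = 0 \<and>
     (\<forall>j\<in>{1..J}. \<forall>k\<in>{1..J}. j \<noteq> k \<longrightarrow> measure M (Y j \<inter> Y k) = 0)"

definition M_part ::
    "'a measure \<Rightarrow> nat \<Rightarrow> (nat \<Rightarrow> 'a set) \<Rightarrow>
     (('a \<Rightarrow> complex) set \<Rightarrow> ('a \<Rightarrow> complex) set) \<Rightarrow> real" where
  "M_part M J Y W = (\<Sum>j=1..J. measure M (Y j) * (op_norm M (W \<circ> L2_proj M (Y j)))\<^sup>2)"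

definition mu_norm ::
    "'a measure \<Rightarrow> (('a \<Rightarrow> complex) set \<Rightarrow> ('a \<Rightarrow> complex) set) \<Rightarrow> real" where
  "mu_norm M W = Inf {sqrt (M_part M J Y W) | J Y. is_partition M J Y}"


lemma equiv_ae_rel: "equiv (sq_integrable M) (ae_rel M)"
proof (rule equivI)
  show "refl_on (sq_integrable M) (ae_rel M)"
    by (auto simp: refl_on_def ae_rel_def)
  show "sym (ae_rel M)"
    by (rule symI) (auto simp: ae_rel_def eq_commute)
  show "trans (ae_rel M)"
  proof (rule transI)
    fix f g h assume "(f, g) \<in> ae_rel M" "(g, h) \<in> ae_rel M"
    then show "(f, h) \<in> ae_rel M"
      unfolding ae_rel_def by (auto elim: AE_mp)
  qed
qed (auto simp: ae_rel_def)

lemma sq_integrable_add: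
  assumes "f \<in> sq_integrable M" "g \<in> sq_integrable M"
  shows "(\<lambda>x. f x + g x) \<in> sq_integrable M"
proof -
  have [measurable]: "f \<in> borel_measurable M" "g \<in> borel_measurable M"
    and i: "integrable M (\<lambda>x. (cmod (f x))\<^sup>2)" "integrable M (\<lambda>x. (cmod (g x))\<^sup>2)"
    using assms by (auto simp: sq_integrable_def)
  have bd: "(cmod (f x + g x))\<^sup>2 \<le> 2 * (cmod (f x))\<^sup>2 + 2 * (cmod (g x))\<^sup>2" for x
  proof -
    have "(cmod (f x + g x))\<^sup>2 \<le> (cmod (f x) + cmod (g x))\<^sup>2"
      by (intro power_mono norm_triangle_ineq) auto
    also have "\<dots> \<le> 2 * (cmod (f x))\<^sup>2 + 2 * (cmod (g x))\<^sup>2"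
      using sum_squares_bound[of "cmod (f x)" "cmod (g x)"] by (simp add: power2_sum)
    finally show ?thesis .
  qed
  have "integrable M (\<lambda>x. (cmod (f x + g x))\<^sup>2)"
    by (rule Bochner_Integration.integrable_bound
        [where f = "\<lambda>x. 2 * (cmod (f x))\<^sup>2 + 2 * (cmod (g x))\<^sup>2"])
      (use i bd in auto)
  then show ?thesis by (simp add: sq_integrable_def)
qed

lemma sq_integrable_scale:
  assumes "f \<in> sq_integrable M"
  shows "(\<lambda>x. c * f x) \<in> sq_integrable M"
  using assms by (auto simp: sq_integrable_def norm_mult power_mult_distrib)

lemma sq_integrable_indicator:
  assumes "f \<in> sq_integrable M" "X \<in> sets M"
  shows "(\<lambda>x. indicator X x * f x) \<in> sq_integrable M"
proof -
  have [measurable]: "f \<in> borel_measurable M" "X \<in> sets M"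
    and i: "integrable M (\<lambda>x. (cmod (f x))\<^sup>2)"
    using assms by (auto simp: sq_integrable_def)
  have "integrable M (\<lambda>x. (cmod (indicator X x * f x))\<^sup>2)"
    by (rule Bochner_Integration.integrable_bound[OF i]) (auto simp: indicator_def)
  then show ?thesis by (simp add: sq_integrable_def)
qed

lemma ae_class_in_L2: "f \<in> sq_integrable M \<Longrightarrow> ae_class M f \<in> L2 M"
  by (simp add: ae_class_def L2_def quotientI)

lemma ae_class_eq:
  assumes "f \<in> sq_integrable M" "g \<in> sq_integrable M"
  shows "ae_class M f = ae_class M g \<longleftrightarrow> (AE x in M. f x = g x)"
  unfolding ae_class_def
  using eq_equiv_class_iff[OF equiv_ae_rel assms] assms by (simp add: ae_rel_def)

lemma rep_ae_class:
  assumes "f \<in> sq_integrable M"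
  shows "rep (ae_class M f) \<in> sq_integrable M" "AE x in M. rep (ae_class M f) x = f x"
proof -
  have "f \<in> ae_class M f"
    using assms by (simp add: ae_class_def ae_rel_def)
  then have "rep (ae_class M f) \<in> ae_class M f"
    unfolding rep_def by (rule someI[of "\<lambda>h. h \<in> ae_class M f"])
  then show "rep (ae_class M f) \<in> sq_integrable M" "AE x in M. rep (ae_class M f) x = f x"
    by (auto simp: ae_class_def ae_rel_def eq_commute)
qed

lemma L2_add_ae_class:
  assumes "f \<in> sq_integrable M" "g \<in> sq_integrable M"
  shows "L2_add M (ae_class M f) (ae_class M g) = ae_class M (\<lambda>x. f x + g x)"
  unfolding L2_add_def
  using rep_ae_class[OF assms(1)] rep_ae_class[OF assms(2)] assms
  by (subst ae_class_eq) (auto intro!: sq_integrable_add)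

lemma L2_scale_ae_class:
  assumes "f \<in> sq_integrable M"
  shows "L2_scale M c (ae_class M f) = ae_class M (\<lambda>x. c * f x)"
  unfolding L2_scale_def
  using rep_ae_class[OF assms] assms
  by (subst ae_class_eq) (auto intro!: sq_integrable_scale)

lemma L2_proj_ae_class:
  assumes "f \<in> sq_integrable M" "X \<in> sets M"
  shows "L2_proj M X (ae_class M f) = ae_class M (\<lambda>x. indicator X x * f x)"
  unfolding L2_proj_def
  using rep_ae_class[OF assms(1)] assms
  by (subst ae_class_eq) (auto intro!: sq_integrable_indicator)

lemma L2_norm_ae_class:
  assumes "f \<in> sq_integrable M"
  shows "L2_norm M (ae_class M f) = sqrt (\<integral>x. (cmod (f x))\<^sup>2 \<partial>M)"
proof -
  have "(\<integral>x. (cmod (rep (ae_class M f) x))\<^sup>2 \<partial>M) = (\<integral>x. (cmod (f x))\<^sup>2 \<partial>M)"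
    using rep_ae_class[OF assms] assms
    by (intro integral_cong_AE) (auto simp: sq_integrable_def)
  then show ?thesis by (simp add: L2_norm_def)
qed

end

theory Submission
  imports Defs "HOL-Analysis.L2_Norm"
begin

text \<open>Restricting an operator to a smaller set does not increase its norm, so \<open>M_part\<close> does not
  increase under refinement. Given partitions \<open>Y\<close> for \<open>W1\<close> and \<open>Z\<close> for \<open>W2\<close>, the common refinement
  by the sets \<open>Y i \<inter> Z j\<close> is at least as good for both operators, and on a single partition the
  claim is the triangle inequality of a weighted finite-dimensional Euclidean norm.\<close>

section \<open>The space of square-integrable classes: projections and the triangle
  inequality\<close>

lemma L2_E:
  assumes "F \<in> L2 M"
  obtains f where "f \<in> sq_integrable M" "F = ae_class M f"
  using assms unfolding L2_def ae_class_def by (auto elim: quotientE)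

lemma L2_norm_nonneg: "0 \<le> L2_norm M F"
  by (simp add: L2_norm_def)

lemma L2_proj_in_L2: "F \<in> L2 M \<Longrightarrow> X \<in> sets M \<Longrightarrow> L2_proj M X F \<in> L2 M"
  by (elim L2_E) (simp add: L2_proj_ae_class ae_class_in_L2 sq_integrable_indicator)

lemma L2_proj_proj:
  assumes "F \<in> L2 M" "X \<in> sets M" "Y \<in> sets M"
  shows "L2_proj M Y (L2_proj M X F) = L2_proj M (X \<inter> Y) F"
proof -
  obtain f where f: "f \<in> sq_integrable M" and F: "F = ae_class M f"
    using assms(1) by (rule L2_E)
  have "(\<lambda>x. indicator Y x * (indicator X x * f x)) = (\<lambda>x. indicator (X \<inter> Y) x * f x)"
    by (auto simp: indicator_def)
  then show ?thesis
    unfolding F using f assms(2,3)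
    by (simp add: L2_proj_ae_class sq_integrable_indicator)
qed

lemma L2_norm_proj_le:
  assumes "F \<in> L2 M" "X \<in> sets M"
  shows "L2_norm M (L2_proj M X F) \<le> L2_norm M F"
proof -
  obtain f where f: "f \<in> sq_integrable M" and F: "F = ae_class M f"
    using assms(1) by (rule L2_E)
  have g: "(\<lambda>x. indicator X x * f x) \<in> sq_integrable M"
    using f assms(2) by (rule sq_integrable_indicator)
  have "(\<integral>x. (cmod (indicator X x * f x))\<^sup>2 \<partial>M) \<le> (\<integral>x. (cmod (f x))\<^sup>2 \<partial>M)"
    using f g by (intro integral_mono) (auto simp: sq_integrable_def indicator_def)
  then show ?thesis
    unfolding F using f g assms(2) by (simp add: L2_proj_ae_class L2_norm_ae_class)
qed

text \<open>The shift by \<open>e\<close> avoids dividing by zero in the optimal choice of \<open>t\<close>.\<close>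
lemma le_add_of_weighted_squares:
  fixes x a b :: real
  assumes ab: "0 \<le> a" "0 \<le> b"
    and le: "\<And>t. 0 < t \<Longrightarrow> x\<^sup>2 \<le> (1 + t) * a\<^sup>2 + (1 + 1 / t) * b\<^sup>2"
  shows "x \<le> a + b"
proof (rule field_le_epsilon)
  fix d :: real assume "0 < d"
  define e where "e = d / 2"
  have e: "0 < e" and d: "d = 2 * e" using \<open>0 < d\<close> by (auto simp: e_def)
  have pos: "0 < a + e" "0 < b + e" using ab e by auto
  \<comment> \<open>This ratio minimises the bound taken at \<open>a + e\<close> and
    \<open>b + e\<close>. Each of the two terms depending on \<open>t\<close> becomes
    \<open>(a + e) * (b + e)\<close>, so the bound collapses to the square of
    \<open>a + e + (b + e) = a + b + d\<close>.\<close>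
  define t where "t = (b + e) / (a + e)"
  have t: "0 < t" "t * (a + e)\<^sup>2 = (a + e) * (b + e)" "1 / t * (b + e)\<^sup>2 = (a + e) * (b + e)"
    using pos by (auto simp: t_def power2_eq_square)
  have "x\<^sup>2 \<le> (1 + t) * a\<^sup>2 + (1 + 1 / t) * b\<^sup>2" using le t(1) by blast
  also have "\<dots> \<le> (1 + t) * (a + e)\<^sup>2 + (1 + 1 / t) * (b + e)\<^sup>2"
    using ab e t(1) by (intro add_mono mult_left_mono power_mono) auto
  also have "\<dots> = (a + e)\<^sup>2 + t * (a + e)\<^sup>2 + ((b + e)\<^sup>2 + 1 / t * (b + e)\<^sup>2)"
    by (simp add: distrib_right)
  also have "\<dots> = (a + b + d)\<^sup>2"
    unfolding t(2,3) d by (simp add: power2_eq_square algebra_simps)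
  finally show "x \<le> a + b + d"
    using ab \<open>0 < d\<close> by (auto intro: power2_le_imp_le)
qed

text \<open>Young's inequality for the cross term \<open>2 * a * b\<close>. For fixed
  \<open>t\<close> the right-hand side is linear in the squares, so it can be integrated termwise
  before \<open>t\<close> is chosen.\<close>

lemma weighted_square_ineq:
  fixes a b t :: real
  assumes "0 < t"
  shows "(a + b)\<^sup>2 \<le> (1 + t) * a\<^sup>2 + (1 + 1 / t) * b\<^sup>2"
proof -
  have "(1 + t) * a\<^sup>2 + (1 + 1 / t) * b\<^sup>2 - (a + b)\<^sup>2 = (t * a - b)\<^sup>2 / t"
    using assms by (simp add: field_simps power2_eq_square)
  moreover have "0 \<le> (t * a - b)\<^sup>2 / t" using assms by simp
  ultimately show ?thesis by linarith
qed

text \<open>The pointwise weighted bound is integrated for each \<open>t\<close>; optimising over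
  \<open>t\<close> afterwards takes the place of the Cauchy-Schwarz inequality.\<close>

lemma L2_norm_triangle:
  assumes "F \<in> L2 M" "G \<in> L2 M"
  shows "L2_norm M (L2_add M F G) \<le> L2_norm M F + L2_norm M G"
proof -
  obtain f where f: "f \<in> sq_integrable M" and F: "F = ae_class M f"
    using assms(1) by (rule L2_E)
  obtain g where g: "g \<in> sq_integrable M" and G: "G = ae_class M g"
    using assms(2) by (rule L2_E)
  have fg: "(\<lambda>x. f x + g x) \<in> sq_integrable M" using f g by (rule sq_integrable_add)
  have sq: "(L2_norm M (ae_class M h))\<^sup>2 = (\<integral>x. (cmod (h x))\<^sup>2 \<partial>M)"
    if "h \<in> sq_integrable M" for h
    using that by (simp add: L2_norm_ae_class)
  show ?thesis
  proof (rule le_add_of_weighted_squares[OF L2_norm_nonneg L2_norm_nonneg])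
    fix t :: real assume t: "0 < t"
    have bd: "(cmod (f x + g x))\<^sup>2 \<le> (1 + t) * (cmod (f x))\<^sup>2 + (1 + 1 / t) * (cmod (g x))\<^sup>2" for x
    proof -
      have "(cmod (f x + g x))\<^sup>2 \<le> (cmod (f x) + cmod (g x))\<^sup>2"
        by (intro power_mono norm_triangle_ineq) auto
      also note weighted_square_ineq[OF t]
      finally show ?thesis .
    qed
    have i: "integrable M (\<lambda>x. (cmod (f x))\<^sup>2)" "integrable M (\<lambda>x. (cmod (g x))\<^sup>2)"
      "integrable M (\<lambda>x. (cmod (f x + g x))\<^sup>2)"
      using f g fg by (auto simp: sq_integrable_def)
    have "(\<integral>x. (cmod (f x + g x))\<^sup>2 \<partial>M)
        \<le> (\<integral>x. (1 + t) * (cmod (f x))\<^sup>2 + (1 + 1 / t) * (cmod (g x))\<^sup>2 \<partial>M)"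
      by (intro integral_mono bd Bochner_Integration.integrable_add integrable_mult_right i)
    also have "\<dots> = (1 + t) * (\<integral>x. (cmod (f x))\<^sup>2 \<partial>M) + (1 + 1 / t) * (\<integral>x. (cmod (g x))\<^sup>2 \<partial>M)"
      by (subst Bochner_Integration.integral_add)
        (intro integrable_mult_right i, intro integrable_mult_right i,
          simp only: integral_mult_right_zero)
    finally show "(L2_norm M (L2_add M F G))\<^sup>2
        \<le> (1 + t) * (L2_norm M F)\<^sup>2 + (1 + 1 / t) * (L2_norm M G)\<^sup>2"
      unfolding F G L2_add_ae_class[OF f g] by (simp only: sq f g fg)
  qed
qed

section \<open>Operator norms of restricted operators\<close>

lemma L2_unit_ball_nonempty: "{F \<in> L2 M. L2_norm M F \<le> 1} \<noteq> {}"
proof -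
  have z: "(\<lambda>x. 0) \<in> sq_integrable M" by (simp add: sq_integrable_def)
  then have "ae_class M (\<lambda>x. 0) \<in> {F \<in> L2 M. L2_norm M F \<le> 1}"
    by (simp add: ae_class_in_L2 L2_norm_ae_class)
  then show ?thesis by blast
qed

lemma op_norm_leI:
  assumes "\<And>F. F \<in> L2 M \<Longrightarrow> L2_norm M F \<le> 1 \<Longrightarrow> L2_norm M (W F) \<le> c"
  shows "op_norm M W \<le> c"
  unfolding op_norm_def using assms
  by (intro cSUP_least L2_unit_ball_nonempty) auto

text \<open>The constant \<open>C\<close> ensures that the supremum is over a set bounded above; a
  real supremum is an upper bound only then.\<close>

lemma L2_norm_le_op_norm:
  assumes "\<And>F. F \<in> L2 M \<Longrightarrow> L2_norm M F \<le> 1 \<Longrightarrow> L2_norm M (W F) \<le> C"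
    and "F \<in> L2 M" "L2_norm M F \<le> 1"
  shows "L2_norm M (W F) \<le> op_norm M W"
proof -
  have "bdd_above ((\<lambda>F. L2_norm M (W F)) ` {F \<in> L2 M. L2_norm M F \<le> 1})"
    using assms(1) by (intro bdd_aboveI2[where M = C]) auto
  then show ?thesis
    unfolding op_norm_def using assms(2,3) by (intro cSUP_upper) auto
qed

lemma op_norm_nonneg:
  assumes "\<And>F. F \<in> L2 M \<Longrightarrow> L2_norm M F \<le> 1 \<Longrightarrow> L2_norm M (W F) \<le> C"
  shows "0 \<le> op_norm M W"
proof -
  obtain F where "F \<in> L2 M" "L2_norm M F \<le> 1"
    using L2_unit_ball_nonempty[of M] by blast
  with assms have "L2_norm M (W F) \<le> op_norm M W" by (rule L2_norm_le_op_norm)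
  then show ?thesis using L2_norm_nonneg[of M "W F"] by linarith
qed

lemma bounded_op_proj_bound:
  assumes "bounded_op M W" "X \<in> sets M"
  obtains C where
    "\<And>F. F \<in> L2 M \<Longrightarrow> L2_norm M F \<le> 1 \<Longrightarrow> L2_norm M ((W \<circ> L2_proj M X) F) \<le> C"
proof -
  have "\<exists>C. \<forall>F\<in>L2 M. L2_norm M (W F) \<le> C * L2_norm M F"
    using assms(1) by (simp add: bounded_op_def)
  then obtain C where C: "\<And>F. F \<in> L2 M \<Longrightarrow> L2_norm M (W F) \<le> C * L2_norm M F"
    by blast
  \<comment> \<open>The definition of \<open>bounded_op\<close> allows a negative \<open>C\<close>,
    hence the absolute value.\<close>
  have "L2_norm M ((W \<circ> L2_proj M X) F) \<le> \<bar>C\<bar>" if F: "F \<in> L2 M" "L2_norm M F \<le> 1" for F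
  proof -
    have "L2_norm M (L2_proj M X F) \<le> 1"
      using L2_norm_proj_le[OF F(1) assms(2)] F(2) by simp
    then have "C * L2_norm M (L2_proj M X F) \<le> \<bar>C\<bar> * 1"
      by (intro mult_mono L2_norm_nonneg) auto
    moreover have "L2_norm M (W (L2_proj M X F)) \<le> C * L2_norm M (L2_proj M X F)"
      using F(1) assms(2) by (intro C L2_proj_in_L2)
    ultimately show ?thesis by simp
  qed
  then show thesis by (rule that)
qed

lemma L2_norm_le_op_norm_proj:
  assumes "bounded_op M W" "X \<in> sets M" "F \<in> L2 M" "L2_norm M F \<le> 1"
  shows "L2_norm M (W (L2_proj M X F)) \<le> op_norm M (W \<circ> L2_proj M X)"
proof -
  obtain C where
    "\<And>F. F \<in> L2 M \<Longrightarrow> L2_norm M F \<le> 1 \<Longrightarrow> L2_norm M ((W \<circ> L2_proj M X) F) \<le> C"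
    using bounded_op_proj_bound[OF assms(1,2)] by blast
  from L2_norm_le_op_norm[of M "W \<circ> L2_proj M X", OF this assms(3,4)] show ?thesis by simp
qed

lemma op_norm_proj_nonneg:
  assumes "bounded_op M W" "X \<in> sets M"
  shows "0 \<le> op_norm M (W \<circ> L2_proj M X)"
proof -
  obtain C where
    "\<And>F. F \<in> L2 M \<Longrightarrow> L2_norm M F \<le> 1 \<Longrightarrow> L2_norm M ((W \<circ> L2_proj M X) F) \<le> C"
    using bounded_op_proj_bound[OF assms] by blast
  then show ?thesis by (rule op_norm_nonneg)
qed

text \<open>Projecting to \<open>X\<close> and then to the larger \<open>Y\<close> is the same as
  projecting to \<open>X\<close>, and the first projection keeps the unit ball inside itself. Every
  value in the supremum for \<open>X\<close> is thus one in the supremum for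
  \<open>Y\<close>.\<close>

lemma op_norm_proj_mono:
  assumes W: "bounded_op M W" and XY: "X \<in> sets M" "Y \<in> sets M" "X \<subseteq> Y"
  shows "op_norm M (W \<circ> L2_proj M X) \<le> op_norm M (W \<circ> L2_proj M Y)"
proof (rule op_norm_leI)
  fix F assume F: "F \<in> L2 M" "L2_norm M F \<le> 1"
  have "L2_proj M X F = L2_proj M Y (L2_proj M X F)"
    using L2_proj_proj[OF F(1) XY(1,2)] XY(3) by (simp add: Int_absorb2)
  moreover have "L2_norm M (W (L2_proj M Y (L2_proj M X F))) \<le> op_norm M (W \<circ> L2_proj M Y)"
    using L2_norm_proj_le[OF F(1) XY(1)] F XY
    by (intro L2_norm_le_op_norm_proj W L2_proj_in_L2) auto
  ultimately show "L2_norm M ((W \<circ> L2_proj M X) F) \<le> op_norm M (W \<circ> L2_proj M Y)"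
    by simp
qed

text \<open>One bound on the unit ball gives both claims: it is an upper bound for the supremum, and
  it is the boundedness from which nonnegativity follows.\<close>

lemma op_norm_add_proj:
  assumes V: "bounded_op M V" and W: "bounded_op M W" and X: "X \<in> sets M"
  shows op_norm_add_proj_le: "op_norm M (op_add M V W \<circ> L2_proj M X)
      \<le> op_norm M (V \<circ> L2_proj M X) + op_norm M (W \<circ> L2_proj M X)" (is "_ \<le> ?c")
    and op_norm_add_proj_nonneg: "0 \<le> op_norm M (op_add M V W \<circ> L2_proj M X)"
proof -
  have *: "L2_norm M ((op_add M V W \<circ> L2_proj M X) F) \<le> ?c"
    if F: "F \<in> L2 M" "L2_norm M F \<le> 1" for F
  proof -
    have P: "L2_proj M X F \<in> L2 M" using F(1) X by (rule L2_proj_in_L2)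
    then have "V (L2_proj M X F) \<in> L2 M" "W (L2_proj M X F) \<in> L2 M"
      using V W by (auto simp: bounded_op_def)
    from L2_norm_triangle[OF this] L2_norm_le_op_norm_proj[OF V X F]
      L2_norm_le_op_norm_proj[OF W X F]
    show ?thesis by (simp add: op_add_def)
  qed
  show "op_norm M (op_add M V W \<circ> L2_proj M X) \<le> ?c" using * by (rule op_norm_leI)
  show "0 \<le> op_norm M (op_add M V W \<circ> L2_proj M X)" using * by (rule op_norm_nonneg)
qed

section \<open>The infimum over partitions, and the inequality on a single partition\<close>

lemma mu_norm_le:
  assumes "is_partition M J Y"
  shows "mu_norm M W \<le> sqrt (M_part M J Y W)"
  unfolding mu_norm_def
proof (rule cInf_lower)
  have "0 \<le> M_part M J Y W" for J Y
    unfolding M_part_def by (intro sum_nonneg) simp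
  then show "bdd_below {sqrt (M_part M J Y W) |J Y. is_partition M J Y}"
    by (intro bdd_belowI[where m = 0]) auto
qed (use assms in blast)

lemma le_mu_normI:
  assumes "\<And>J Y. is_partition M J Y \<Longrightarrow> c \<le> sqrt (M_part M J Y W)"
  shows "c \<le> mu_norm M W"
  unfolding mu_norm_def
proof (rule cInf_greatest)
  \<comment> \<open>The one-member partition makes the set nonempty, as a greatest lower bound in
    the reals requires.\<close>
  have "is_partition M 1 (\<lambda>_. space M)" by (auto simp: is_partition_def)
  then show "{sqrt (M_part M J Y W) |J Y. is_partition M J Y} \<noteq> {}" by blast
qed (use assms in auto)

lemma sqrt_M_part_add_le:
  assumes V: "bounded_op M V" and W: "bounded_op M W" and Y: "is_partition M J Y"
  shows "sqrt (M_part M J Y (op_add M V W)) \<le> sqrt (M_part M J Y V) + sqrt (M_part M J Y W)"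
proof -
  \<comment> \<open>Moving the root of the weight into the entry turns the root of
    \<open>M_part\<close> into a plain Euclidean norm.\<close>
  define n where "n U j = sqrt (measure M (Y j)) * op_norm M (U \<circ> L2_proj M (Y j))" for U j
  have eq: "sqrt (M_part M J Y U) = L2_set (n U) {1..J}" for U
    by (simp add: M_part_def L2_set_def n_def power_mult_distrib)
  have meas: "Y j \<in> sets M" if "j \<in> {1..J}" for j
    using Y that by (auto simp: is_partition_def)
  \<comment> \<open>Monotonicity of the Euclidean norm needs nonnegative entries on the left, which
    is where \<open>op_norm_add_proj_nonneg\<close> enters.\<close>
  have "L2_set (n (op_add M V W)) {1..J} \<le> L2_set (\<lambda>j. n V j + n W j) {1..J}"
    using op_norm_add_proj_le[OF V W meas] op_norm_add_proj_nonneg[OF V W meas]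
    by (intro L2_set_mono) (auto simp: n_def distrib_left[symmetric] intro!: mult_left_mono)
  also have "\<dots> \<le> L2_set (n V) {1..J} + L2_set (n W) {1..J}"
    by (rule L2_set_triangle_ineq)
  finally show ?thesis unfolding eq .
qed

section \<open>Common refinement of two partitions\<close>

text \<open>The pieces overlap only in null sets, so their measures add up to that of their union,
  which lies in \<open>X\<close>.\<close>

lemma (in prob_space) sum_measure_Int_partition_le:
  assumes Z: "is_partition M K Z" and X: "X \<in> sets M"
  shows "(\<Sum>k=1..K. measure M (X \<inter> Z k)) \<le> measure M X"
proof -
  have meas: "\<And>k. k \<in> {1..K} \<Longrightarrow> Z k \<in> sets M"
    and null: "\<And>j k. j \<in> {1..K} \<Longrightarrow> k \<in> {1..K} \<Longrightarrow> j \<noteq> k \<Longrightarrow> measure M (Z j \<inter> Z k) = 0"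
    using Z by (auto simp: is_partition_def)
  have "pairwise (\<lambda>j k. AE x in M. x \<notin> X \<inter> Z j \<or> x \<notin> X \<inter> Z k) {1..K}"
  proof (rule pairwiseI)
    fix j k assume jk: "j \<in> {1..K}" "k \<in> {1..K}" "j \<noteq> k"
    have "Z j \<inter> Z k \<in> null_sets M"
      using null[OF jk] meas jk by (intro null_setsI) (auto simp: emeasure_eq_measure)
    then show "AE x in M. x \<notin> X \<inter> Z j \<or> x \<notin> X \<inter> Z k"
      by (rule AE_mp[OF AE_not_in]) auto
  qed
  then have "(\<Sum>k=1..K. measure M (X \<inter> Z k)) = measure M (\<Union>k\<in>{1..K}. X \<inter> Z k)"
    using meas X by (intro measure_UNION_AE[symmetric]) (auto simp: fmeasurable_eq_sets)
  also have "\<dots> \<le> measure M X"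
    using X by (intro finite_measure_mono) auto
  finally show ?thesis .
qed

text \<open>Within one \<open>Y i\<close>, the norm on each piece is replaced by the larger norm on
  \<open>Y i\<close>; the weights of the pieces then sum to at most that of
  \<open>Y i\<close>.\<close>

lemma (in prob_space) sum_refined_le_M_part:
  assumes W: "bounded_op M W" and Y: "is_partition M J Y" and Z: "is_partition M K Z"
  shows "(\<Sum>i=1..J. \<Sum>k=1..K. measure M (Y i \<inter> Z k) * (op_norm M (W \<circ> L2_proj M (Y i \<inter> Z k)))\<^sup>2)
    \<le> M_part M J Y W"
  unfolding M_part_def
proof (rule sum_mono)
  fix i assume i: "i \<in> {1..J}"
  let ?c = "(op_norm M (W \<circ> L2_proj M (Y i)))\<^sup>2"
  have Yi: "Y i \<in> sets M" using Y i by (auto simp: is_partition_def)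
  have Zk: "\<And>k. k \<in> {1..K} \<Longrightarrow> Z k \<in> sets M" using Z by (auto simp: is_partition_def)
  have "(\<Sum>k=1..K. measure M (Y i \<inter> Z k) * (op_norm M (W \<circ> L2_proj M (Y i \<inter> Z k)))\<^sup>2)
      \<le> (\<Sum>k=1..K. measure M (Y i \<inter> Z k) * ?c)"
    by (intro sum_mono mult_left_mono power_mono op_norm_proj_mono op_norm_proj_nonneg W sets.Int Yi Zk) auto
  also have "\<dots> \<le> measure M (Y i) * ?c"
    using sum_measure_Int_partition_le[OF Z Yi]
    by (simp add: sum_distrib_right[symmetric] mult_right_mono)
  finally show "(\<Sum>k=1..K. measure M (Y i \<inter> Z k) * (op_norm M (W \<circ> L2_proj M (Y i \<inter> Z k)))\<^sup>2)
      \<le> measure M (Y i) * ?c" .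
qed

text \<open>The bijection \<open>h\<close> lists the index pairs as \<open>1..N\<close>, the form
  that \<open>is_partition\<close> asks for. A point missed by the refinement is missed by
  \<open>Y\<close> or by \<open>Z\<close>, and two distinct pairs differ in a coordinate, so their
  pieces meet inside an overlap of \<open>Y\<close> or of \<open>Z\<close>.\<close>

lemma (in prob_space) is_partition_refine:
  assumes Y: "is_partition M J Y" and Z: "is_partition M K Z"
    and h: "bij_betw h {1..N} ({1..J} \<times> {1..K})"
  shows "is_partition M N (\<lambda>n. Y (fst (h n)) \<inter> Z (snd (h n)))"
  unfolding is_partition_def
proof (intro conjI ballI impI)
  have Ym: "\<And>j. j \<in> {1..J} \<Longrightarrow> Y j \<in> sets M" and Zm: "\<And>k. k \<in> {1..K} \<Longrightarrow> Z k \<in> sets M"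
    using Y Z by (auto simp: is_partition_def)
  have hm: "fst (h n) \<in> {1..J}" "snd (h n) \<in> {1..K}" if "n \<in> {1..N}" for n
    using bij_betwE[OF h] that by (auto simp: mem_Times_iff)
  show "Y (fst (h n)) \<inter> Z (snd (h n)) \<in> sets M" if "n \<in> {1..N}" for n
    using hm[OF that] Ym Zm by blast
  have subset_null: "measure M A = 0" if "measure M B = 0" "B \<in> sets M" "A \<subseteq> B" for A B
    using finite_measure_mono[OF that(3,2)] that(1) by (simp add: measure_le_0_iff)
  have "(\<Union>n\<in>{1..N}. Y (fst (h n)) \<inter> Z (snd (h n)))
      = (\<Union>p\<in>h ` {1..N}. Y (fst p) \<inter> Z (snd p))"
    by simp
  also have "\<dots> = (\<Union>j\<in>{1..J}. Y j) \<inter> (\<Union>k\<in>{1..K}. Z k)"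
    unfolding bij_betw_imp_surj_on[OF h] by auto
  finally have un: "space M - (\<Union>n\<in>{1..N}. Y (fst (h n)) \<inter> Z (snd (h n)))
      = (space M - (\<Union>j\<in>{1..J}. Y j)) \<union> (space M - (\<Union>k\<in>{1..K}. Z k))"
    by auto
  have "measure M (\<dots>) \<le> measure M (space M - (\<Union>j\<in>{1..J}. Y j)) + measure M (space M - (\<Union>k\<in>{1..K}. Z k))"
    using Ym Zm by (intro measure_Un_le) auto
  also have "\<dots> = 0" using Y Z by (simp add: is_partition_def)
  finally show "measure M (space M - (\<Union>n\<in>{1..N}. Y (fst (h n)) \<inter> Z (snd (h n)))) = 0"
    unfolding un by (simp add: measure_le_0_iff)
  fix m n assume mn: "m \<in> {1..N}" "n \<in> {1..N}" "m \<noteq> n"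
  then have "h m \<noteq> h n" using bij_betw_imp_inj_on[OF h] by (auto dest: inj_onD)
  then consider "fst (h m) \<noteq> fst (h n)" | "snd (h m) \<noteq> snd (h n)"
    by (auto simp: prod_eq_iff)
  then show "measure M (Y (fst (h m)) \<inter> Z (snd (h m)) \<inter> (Y (fst (h n)) \<inter> Z (snd (h n)))) = 0"
  proof cases
    case 1
    then have "measure M (Y (fst (h m)) \<inter> Y (fst (h n))) = 0"
      using Y hm[OF mn(1)] hm[OF mn(2)] by (simp add: is_partition_def)
    moreover have "Y (fst (h m)) \<inter> Y (fst (h n)) \<in> sets M"
      using mn(1,2) by (intro sets.Int Ym hm)
    ultimately show ?thesis by (rule subset_null) blast
  next
    case 2
    then have "measure M (Z (snd (h m)) \<inter> Z (snd (h n))) = 0"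
      using Z hm[OF mn(1)] hm[OF mn(2)] by (simp add: is_partition_def)
    moreover have "Z (snd (h m)) \<inter> Z (snd (h n)) \<in> sets M"
      using mn(1,2) by (intro sets.Int Zm hm)
    ultimately show ?thesis by (rule subset_null) blast
  qed
qed

lemma (in prob_space) common_refinement:
  assumes Y: "is_partition M J Y" and Z: "is_partition M K Z"
    and V: "bounded_op M V" and W: "bounded_op M W"
  obtains N P where "is_partition M N P"
    "M_part M N P V \<le> M_part M J Y V" "M_part M N P W \<le> M_part M K Z W"
proof -
  have "finite ({1..J} \<times> {1..K})" by simp
  then obtain h where h: "bij_betw h {1..card ({1..J} \<times> {1..K})} ({1..J} \<times> {1..K})"
    by (rule ex_bij_betw_nat_finite_1[THEN exE])
  define N where "N = card ({1..J} \<times> {1..K})"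
  note h = h[folded N_def]
  define P where "P n = Y (fst (h n)) \<inter> Z (snd (h n))" for n
  \<comment> \<open>Reindexing along \<open>h\<close> removes the enumeration and leaves a double
    sum that can be estimated by rows or by columns.\<close>
  have M_part_P: "M_part M N P U
      = (\<Sum>i=1..J. \<Sum>k=1..K. measure M (Y i \<inter> Z k) * (op_norm M (U \<circ> L2_proj M (Y i \<inter> Z k)))\<^sup>2)"
    for U
    unfolding M_part_def P_def sum.cartesian_product
    by (subst sum.reindex_bij_betw[OF h, symmetric]) (simp add: case_prod_beta)
  show thesis
  proof
    show "is_partition M N P"
      unfolding P_def using Y Z h by (rule is_partition_refine)
    show "M_part M N P V \<le> M_part M J Y V"
      unfolding M_part_P using V Y Z by (rule sum_refined_le_M_part)
    show "M_part M N P W \<le> M_part M K Z W"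
      \<comment> \<open>For \<open>W\<close> the same pieces are read as a refinement of
        \<open>Z\<close> by \<open>Y\<close>, so the order of summation is exchanged.\<close>
      unfolding M_part_P using sum_refined_le_M_part[OF W Z Y]
      by (subst sum.swap) (simp add: Int_commute)
  qed
qed

theorem lemma2p3:
  fixes M :: "'a measure"
    and W1 W2 :: "('a \<Rightarrow> complex) set \<Rightarrow> ('a \<Rightarrow> complex) set"
  assumes "prob_space M"
    and "bounded_op M W1"
    and "bounded_op M W2"
  shows "mu_norm M (op_add M W1 W2) \<le> mu_norm M W1 + mu_norm M W2"
proof -
  interpret prob_space M by fact
  have main: "mu_norm M (op_add M W1 W2) \<le> sqrt (M_part M J Y W1) + sqrt (M_part M K Z W2)"
    if Y: "is_partition M J Y" and Z: "is_partition M K Z" for J Y K Z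
  proof -
    obtain N P where P: "is_partition M N P"
      "M_part M N P W1 \<le> M_part M J Y W1" "M_part M N P W2 \<le> M_part M K Z W2"
      using common_refinement[OF Y Z assms(2,3)] by blast
    have "mu_norm M (op_add M W1 W2) \<le> sqrt (M_part M N P (op_add M W1 W2))"
      using P(1) by (rule mu_norm_le)
    also have "\<dots> \<le> sqrt (M_part M N P W1) + sqrt (M_part M N P W2)"
      using assms(2,3) P(1) by (rule sqrt_M_part_add_le)
    also have "\<dots> \<le> sqrt (M_part M J Y W1) + sqrt (M_part M K Z W2)"
      using P(2,3) by (intro add_mono real_sqrt_le_mono)
    finally show ?thesis .
  qed
  \<comment> \<open>The two infima are taken one after the other: with \<open>Z\<close> fixed, over
    all \<open>Y\<close>, and then over all \<open>Z\<close>. Subtracting a term gives each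
    inequality the form of a lower bound on one \<open>mu_norm\<close>.\<close>
  have "mu_norm M (op_add M W1 W2) - mu_norm M W1 \<le> mu_norm M W2"
  proof (rule le_mu_normI)
    fix K Z assume Z: "is_partition M K Z"
    have "mu_norm M (op_add M W1 W2) - sqrt (M_part M K Z W2) \<le> mu_norm M W1"
      using main[OF _ Z] by (intro le_mu_normI) (simp add: algebra_simps)
    then show "mu_norm M (op_add M W1 W2) - mu_norm M W1 \<le> sqrt (M_part M K Z W2)" by simp
  qed
  then show ?thesis by simp
qed

end
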